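(* Let $p>0$, $q\in\mathbb{R}$, and suppose that the kernel $k\in C^0([0,1])$ achieves Input-to-State Stabilization with gain $\frac{\gamma}{p\pi^2}\ge0$ of the system $$u_t(t,x)=p\,u_{xx}(t,x)-q\,u(t,x)+v(t,x)\ (t>0,\ x\in(0,1)),\qquad u(t,0)=0,\quad u(t,1)=U(t)\ (t>0).$$ Let $f:L^2(0,1)\to L^2(0,1)$ be a continuous mapping satisfying the following assumption: there exist a countable family of continuous functionals $\bar K_i:L^2(0,1)\to\mathbb{R}$, $i=1,2,\ldots$, and constants $\bar P_i\ge0$, $\bar\omega_i>0$, $i=1,2,\ldots$, satisfying $$|\bar K_i(u)|\le\bar P_i\|u\|\quad\text{for }i=1,2,\ldots\text{ and }u\in L^2(0,1),\qquad\qquad\sum_{i=1}^\infty\bar\omega_i^{-2}\bar P_i\|\bar\varphi_i\|<1,$$ where the functions $\bar\varphi_i$ on $[0,1]$ are given by $\bar\varphi_i(x)=x$ when $q=\bar\omega_i^2$, $\bar\varphi_i(x)=\sin\left(x\sqrt{p^{-1}(\bar\omega_i^2-q)}\right)$ when $q<\bar\omega_i^2$, and $\bar\varphi_i(x)=\sinh\left(x\sqrt{p^{-1}(q-\bar\omega_i^2)}\right)$ when $q>\bar\omega_i^2$, such that for every $\varepsilon>0$ there exists an integer $N\ge1$ satisfying $$\left\|f(u)-\sum_{i=1}^N\bar\varphi_i\bar K_i(u)\right\|\le\varepsilon\|u\|\quad\text{for all }u\in L^2(0,1).$$ Then there exist an integer $n\ge1$, functions $\varphi_i\in C^2([0,1])$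 with $\varphi_i(0)=0$ ($i=1,\ldots,n$), continuous functionals $K_i:L^2(0,1)\to\mathbb{R}$ ($i=1,\ldots,n$), and constants $\omega_i>0$ ($i=1,\ldots,n$), such that $0\in L^2(0,1)\times\mathbb{R}^n$ is globally exponentially stable for the closed-loop system $$u_t(t,x)=p\,u_{xx}(t,x)-q\,u(t,x)+(f(u[t]))(x)\quad(t>0,\ x\in(0,1)),$$ $$u(t,0)=0,\qquad u(t,1)=\sum_{i=1}^n\varphi_i(1)\xi_i(t)+\int_0^1k(x)u(t,x)\,dx-\sum_{i=1}^n\xi_i(t)\int_0^1\varphi_i(x)k(x)\,dx\quad(t>0),$$ $$\dot\xi_i(t)=-\omega_i^2\xi_i(t)+K_i(u[t])\quad(t>0),\qquad i=1,\ldots,n.$$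
   Context: Notation: $\mathbb{R}_+=[0,+\infty)$; $\|\cdot\|$ is the norm of $L^2(0,1)$, $\|g\|=\left(\int_0^1|g(x)|^2dx\right)^{1/2}$; for $u:\mathbb{R}_+\times[0,1]\to\mathbb{R}$, $u[t]$ denotes the profile $(u[t])(x)=u(t,x)$; $C^0(\mathbb{R}_+;L^2(0,1))$ is the class of functions for which $t\mapsto u[t]\in L^2(0,1)$ is continuous. Definition (Input-to-State Stabilization). Consider $u_t=p u_{xx}-q u+v$ for $t>0$, $x\in(0,1)$, with $u(t,0)=0$, $u(t,1)=U(t)$ for $t>0$, where $v:\mathbb{R}_+\times[0,1]\to\mathbb{R}$ is a distributed input (with $v[t]\in L^2(0,1)$) and $U$ is the control input. A kernel $k\in C^0([0,1])$ achieves Input-to-State Stabilization with gain $g\ge 0$ of this system if there exist constants $G,\sigma>0$ such that (for every distributed input $v$) every solution $u\in C^0(\mathbb{R}_+;L^2(0,1))\cap C^1((0,+\infty)\times[0,1])$ with $u[t]\in C^2([0,1])$ for $t>0$ of the closed-loop system with $U(t)=\int_0^1k(x)u(t,x)\,dx$ for $t>0$ satisfies $$\|u[t]\|\le G\exp(-\sigma t)\|u[0]\|+g\sup_{0\le s\le t}\|v[s]\|\quad\text{for all }t\ge 0.$$ Definition (global exponential stability). $0\in L^2(0,1)\times\mathbb{R}^n$ is globally exponentially stable for the closed-loop system in $(u,\xi_1,\ldots,\xi_n)$ if there exist constants $R,\delta>0$ such that every solution $u\in C^0(\mathbb{R}_+;L^2(0,1))\cap C^1((0,+\infty)\times[0,1])$,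 $\xi_i\in C^0(\mathbb{R}_+)\cap C^1((0,+\infty))$, $i=1,\ldots,n$, with $u[t]\in C^2([0,1])$ for $t>0$, of the closed-loop system satisfies $$\|u[t]\|+\sum_{i=1}^n|\xi_i(t)|\le R\exp(-\delta t)\left(\|u[0]\|+\sum_{i=1}^n|\xi_i(0)|\right)\quad\text{for all }t\ge0.$$ *)

theory Defs
  imports "HOL-Analysis.Analysis"
begin

abbreviation M01 :: "real measure" where
  "M01 \<equiv> lebesgue_on {0<..<1}"

definition square_integrable :: "(real \<Rightarrow> real) \<Rightarrow> bool" where
  "square_integrable g \<longleftrightarrow> g \<in> borel_measurable M01 \<and> integrable M01 (\<lambda>x. (g x)\<^sup>2)"

definition L2_rel :: "(real \<Rightarrow> real) \<Rightarrow> (real \<Rightarrow> real) \<Rightarrow> bool" where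
  "L2_rel g h \<longleftrightarrow> square_integrable g \<and> square_integrable h \<and> (AE x in M01. g x = h x)"

lemma square_integrable_zero: "square_integrable (\<lambda>x. 0)"
  by (simp add: square_integrable_def)

lemma integrable_mult_L2:
  assumes "square_integrable g" "square_integrable h"
  shows "integrable M01 (\<lambda>x. g x * h x)"
proof (rule Bochner_Integration.integrable_bound)
  show "integrable M01 (\<lambda>x. (g x)\<^sup>2 + (h x)\<^sup>2)"
    using assms by (auto simp: square_integrable_def)
  show "(\<lambda>x. g x * h x) \<in> borel_measurable M01"
    using assms by (auto simp: square_integrable_def)
  have "\<bar>a * b\<bar> \<le> a\<^sup>2 + b\<^sup>2" for a b :: real
  proof -
    have "2 * (\<bar>a\<bar> * \<bar>b\<bar>) \<le> a\<^sup>2 + b\<^sup>2"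
      using sum_squares_bound[of "\<bar>a\<bar>" "\<bar>b\<bar>"] by simp
    moreover have "0 \<le> \<bar>a\<bar> * \<bar>b\<bar>" by simp
    ultimately show ?thesis unfolding abs_mult by linarith
  qed
  then show "AE x in M01. norm (g x * h x) \<le> norm ((g x)\<^sup>2 + (h x)\<^sup>2)"
    by simp
qed

lemma square_integrable_add:
  assumes "square_integrable g" "square_integrable h"
  shows "square_integrable (\<lambda>x. g x + h x)"
  using assms integrable_mult_L2[OF assms]
  by (auto simp: square_integrable_def power2_sum mult.assoc)

lemma square_integrable_scale:
  assumes "square_integrable g"
  shows "square_integrable (\<lambda>x. c * g x)"
  using assms by (auto simp: square_integrable_def power_mult_distrib)

lemma square_integrable_uminus:
  assumes "square_integrable g"
  shows "square_integrable (\<lambda>x. - g x)"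
  using assms by (auto simp: square_integrable_def)

lemma square_integrable_diff:
  assumes "square_integrable g" "square_integrable h"
  shows "square_integrable (\<lambda>x. g x - h x)"
  using square_integrable_add[OF assms(1) square_integrable_uminus[OF assms(2)]] by simp

text \<open>\<open>L2_of g\<close> is the class of \<open>g\<close>, meaningful only for square-integrable \<open>g\<close>;
  \<open>rep_L2 a\<close> is some representative of the class \<open>a\<close>, so only its values almost everywhere
  are meaningful.\<close>

quotient_type L2 = "real \<Rightarrow> real" / partial: L2_rel
  morphisms rep_L2 L2_of
proof (rule part_equivpI)
  show "\<exists>x. L2_rel x x"
    by (auto simp: L2_rel_def intro!: exI[of _ "\<lambda>x. 0"] square_integrable_zero)
  show "symp L2_rel"
    by (auto simp: symp_def L2_rel_def elim: eventually_mono)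
  show "transp L2_rel"
    unfolding transp_def L2_rel_def by (auto elim: eventually_elim2)
qed

instantiation L2 :: real_inner
begin

lift_definition zero_L2 :: L2 is "\<lambda>x. 0"
  by (simp add: L2_rel_def square_integrable_zero)

lift_definition plus_L2 :: "L2 \<Rightarrow> L2 \<Rightarrow> L2" is "\<lambda>g h x. g x + h x"
  unfolding L2_rel_def by (auto intro: square_integrable_add elim: eventually_elim2)

lift_definition minus_L2 :: "L2 \<Rightarrow> L2 \<Rightarrow> L2" is "\<lambda>g h x. g x - h x"
  unfolding L2_rel_def by (auto intro: square_integrable_diff elim: eventually_elim2)

lift_definition uminus_L2 :: "L2 \<Rightarrow> L2" is "\<lambda>g x. - g x"
  unfolding L2_rel_def by (auto intro: square_integrable_uminus elim: eventually_mono)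

lift_definition scaleR_L2 :: "real \<Rightarrow> L2 \<Rightarrow> L2" is "\<lambda>c g x. c * g x"
  unfolding L2_rel_def by (auto intro: square_integrable_scale elim: eventually_mono)

lift_definition inner_L2 :: "L2 \<Rightarrow> L2 \<Rightarrow> real" is "\<lambda>g h. LINT x|M01. g x * h x"
proof -
  fix g g' h h' assume a: "L2_rel g g'" "L2_rel h h'"
  show "(LINT x|M01. g x * h x) = (LINT x|M01. g' x * h' x)"
  proof (rule integral_cong_AE)
    show "(\<lambda>x. g x * h x) \<in> borel_measurable M01" "(\<lambda>x. g' x * h' x) \<in> borel_measurable M01"
      using a by (auto simp: L2_rel_def square_integrable_def)
    have "AE x in M01. g x = g' x" "AE x in M01. h x = h' x"
      using a by (auto simp: L2_rel_def)
    then show "AE x in M01. g x * h x = g' x * h' x" by eventually_elim simp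
  qed
qed

definition norm_L2 :: "L2 \<Rightarrow> real" where "norm_L2 a = sqrt (inner a a)"

definition sgn_L2 :: "L2 \<Rightarrow> L2" where "sgn_L2 a = inverse (norm a) *\<^sub>R a"

definition dist_L2 :: "L2 \<Rightarrow> L2 \<Rightarrow> real" where "dist_L2 a b = norm (a - b)"

definition uniformity_L2 :: "(L2 \<times> L2) filter" where
  "uniformity_L2 = (INF e\<in>{0<..}. principal {(a, b). dist a b < e})"

definition open_L2 :: "L2 set \<Rightarrow> bool" where
  "open_L2 U \<longleftrightarrow> (\<forall>a\<in>U. eventually (\<lambda>(a', b). a' = a \<longrightarrow> b \<in> U) uniformity)"

instance
proof
  fix a b c :: L2 and r s :: real
  show "a + b + c = a + (b + c)"
    by transfer (auto simp: L2_rel_def add.assoc intro!: square_integrable_add)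
  show "a + b = b + a"
    by transfer (auto simp: L2_rel_def add.commute intro!: square_integrable_add)
  show "0 + a = a"
    by transfer (auto simp: L2_rel_def)
  show "- a + a = 0"
    by transfer (auto simp: L2_rel_def square_integrable_zero)
  show "a - b = a + - b"
    by transfer (auto simp: L2_rel_def square_integrable_diff)
  show "r *\<^sub>R (a + b) = r *\<^sub>R a + r *\<^sub>R b"
    by transfer
      (auto simp: L2_rel_def distrib_left intro!: square_integrable_add square_integrable_scale)
  show "(r + s) *\<^sub>R a = r *\<^sub>R a + s *\<^sub>R a"
    by transfer
      (auto simp: L2_rel_def distrib_right intro!: square_integrable_add square_integrable_scale)
  show "r *\<^sub>R s *\<^sub>R a = (r * s) *\<^sub>R a"
    by transfer (auto simp: L2_rel_def mult.assoc intro!: square_integrable_scale)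
  show "1 *\<^sub>R a = a"
    by transfer (auto simp: L2_rel_def)
  show "dist a b = norm (a - b)" by (rule dist_L2_def)
  show "sgn a = inverse (norm a) *\<^sub>R a" by (rule sgn_L2_def)
  show "uniformity = (INF e\<in>{0<..}. principal {(a :: L2, b). dist a b < e})"
    by (rule uniformity_L2_def)
  show "open U \<longleftrightarrow> (\<forall>a\<in>U. eventually (\<lambda>(a', b). a' = a \<longrightarrow> b \<in> U) uniformity)" for U :: "L2 set"
    by (rule open_L2_def)
  show "inner a b = inner b a"
    by transfer (simp add: mult.commute)
  show "inner (a + b) c = inner a c + inner b c"
    by transfer (auto simp: L2_rel_def distrib_right integrable_mult_L2)
  show "inner (r *\<^sub>R a) b = r * inner a b"
    by transfer (simp add: mult.assoc)
  show "0 \<le> inner a a"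
    by transfer simp
  show "inner a a = 0 \<longleftrightarrow> a = 0"
    by transfer
      (auto simp: L2_rel_def square_integrable_zero integral_nonneg_eq_0_iff_AE integrable_mult_L2)
  show "norm a = sqrt (inner a a)" by (rule norm_L2_def)
qed

end

lemma norm_L2_of:
  assumes "square_integrable g"
  shows "norm (L2_of g) = sqrt (LINT x|M01. \<bar>g x\<bar>\<^sup>2)"
proof -
  have "inner (L2_of g) (L2_of g) = (LINT x|M01. g x * g x)"
    using assms by (intro inner_L2.abs_eq) (auto simp: L2_rel_def)
  then show ?thesis by (simp add: norm_L2_def power2_eq_square)
qed

lemma L2_of_eq_iff:
  assumes "square_integrable g" "square_integrable h"
  shows "L2_of g = L2_of h \<longleftrightarrow> (AE x in M01. g x = h x)"
  using assms Quotient3_rel[OF Quotient3_L2, of g h] by (auto simp: L2_rel_def)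

lemma square_integrable_continuous:
  assumes "continuous_on {0..1} g"
  shows "square_integrable g"
proof -
  have "g \<in> borel_measurable (lebesgue_on {0<..<1})"
    by (rule continuous_imp_measurable_on_sets_lebesgue)
      (auto intro: continuous_on_subset[OF assms])
  moreover have "(\<lambda>x. (g x)\<^sup>2) absolutely_integrable_on {0..1}"
    by (intro absolutely_integrable_continuous_real continuous_intros assms)
  then have "(\<lambda>x. (g x)\<^sup>2) absolutely_integrable_on {0<..<1}"
    by (rule set_integrable_subset) auto
  then have "integrable M01 (\<lambda>x. (g x)\<^sup>2)"
    by (simp add: absolutely_integrable_on_def set_integrable_def integrable_restrict_space)
  ultimately show ?thesis by (simp add: square_integrable_def)
qed

lemma square_integrable_rep_L2: "square_integrable (rep_L2 a)"
  using Quotient3_rep_reflp[OF Quotient3_L2, of a] by (simp add: L2_rel_def)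

lemma L2_of_rep_L2: "L2_of (rep_L2 a) = a"
  by (rule Quotient3_abs_rep[OF Quotient3_L2])

text \<open>Functions on $[0,1]$ are total functions on the reals whose values outside $[0,1]$ are
  irrelevant; derivatives at the end points are one-sided.\<close>

definition C2_on_01 :: "(real \<Rightarrow> real) \<Rightarrow> bool" where
  "C2_on_01 g \<longleftrightarrow> (\<exists>g' g''.
     (\<forall>x\<in>{0..1}. (g has_real_derivative g' x) (at x within {0..1})) \<and>
     (\<forall>x\<in>{0..1}. (g' has_real_derivative g'' x) (at x within {0..1})) \<and>
     continuous_on {0..1} g'')"

definition C1_on_strip :: "(real \<Rightarrow> real \<Rightarrow> real) \<Rightarrow> bool" where
  "C1_on_strip u \<longleftrightarrow> (\<exists>ut ux.
     (\<forall>t>0. \<forall>x\<in>{0..1}. ((\<lambda>s. u s x) has_real_derivative ut t x) (at t)) \<and>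
     (\<forall>t>0. \<forall>x\<in>{0..1}. (u t has_real_derivative ux t x) (at x within {0..1})) \<and>
     continuous_on ({0<..} \<times> {0..1}) (\<lambda>(t, x). ut t x) \<and>
     continuous_on ({0<..} \<times> {0..1}) (\<lambda>(t, x). ux t x))"

text \<open>The class $C^0(\mathbb{R}_+;L^2(0,1))\cap C^1((0,+\infty)\times[0,1])$ with
  $u[t]\in C^2([0,1])$ for $t>0$, where $u[t]$ is \<open>u t\<close>.\<close>

definition regular :: "(real \<Rightarrow> real \<Rightarrow> real) \<Rightarrow> bool" where
  "regular u \<longleftrightarrow>
     (\<forall>t\<ge>0. square_integrable (u t)) \<and> continuous_on {0..} (\<lambda>t. L2_of (u t)) \<and>
     C1_on_strip u \<and> (\<forall>t>0. C2_on_01 (u t))"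

definition pde_closed_loop ::
  "real \<Rightarrow> real \<Rightarrow> (real \<Rightarrow> real) \<Rightarrow> (real \<Rightarrow> real \<Rightarrow> real) \<Rightarrow> (real \<Rightarrow> real \<Rightarrow> real) \<Rightarrow> bool" where
  "pde_closed_loop p q k v u \<longleftrightarrow>
     regular u \<and>
     (\<forall>t>0. \<forall>x\<in>{0<..<1}.
        deriv (\<lambda>s. u s x) t = p * (deriv ^^ 2) (u t) x - q * u t x + v t x) \<and>
     (\<forall>t>0. u t 0 = 0) \<and>
     (\<forall>t>0. u t 1 = integral {0..1} (\<lambda>x. k x * u t x))"

text \<open>The supremum is taken in the extended nonnegative reals because nothing bounds
  $\|v[s]\|$ on $[0,t]$; the estimate carries no information when it is infinite and \<open>g > 0\<close>.\<close>

definition achieves_ISS :: "real \<Rightarrow> real \<Rightarrow> (real \<Rightarrow> real) \<Rightarrow> real \<Rightarrow> bool" where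
  "achieves_ISS p q k g \<longleftrightarrow>
     (\<exists>G>0. \<exists>\<sigma>>0. \<forall>v u.
        (\<forall>t\<ge>0. square_integrable (v t)) \<longrightarrow> pde_closed_loop p q k v u \<longrightarrow>
        (\<forall>t\<ge>0. ennreal (norm (L2_of (u t)))
           \<le> ennreal (G * exp (- \<sigma> * t) * norm (L2_of (u 0)))
             + ennreal g * (SUP s\<in>{0..t}. ennreal (norm (L2_of (v s))))))"

text \<open>Since \<open>f\<close> takes values in $L^2(0,1)$, the differential equation can only be read almost
  everywhere in \<open>x\<close>.\<close>

definition closed_loop ::
  "real \<Rightarrow> real \<Rightarrow> (real \<Rightarrow> real) \<Rightarrow> (L2 \<Rightarrow> L2) \<Rightarrow> nat \<Rightarrow> (nat \<Rightarrow> real \<Rightarrow> real) \<Rightarrow> (nat \<Rightarrow> L2 \<Rightarrow> real) \<Rightarrow>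
   (nat \<Rightarrow> real) \<Rightarrow> (real \<Rightarrow> real \<Rightarrow> real) \<Rightarrow> (nat \<Rightarrow> real \<Rightarrow> real) \<Rightarrow> bool" where
  "closed_loop p q k f n \<phi> K \<omega> u \<xi> \<longleftrightarrow>
     regular u \<and>
     (\<forall>i\<in>{1..n}. continuous_on {0..} (\<xi> i) \<and> \<xi> i C1_differentiable_on {0<..}) \<and>
     (\<forall>t>0. AE x in M01.
        deriv (\<lambda>s. u s x) t = p * (deriv ^^ 2) (u t) x - q * u t x + rep_L2 (f (L2_of (u t))) x) \<and>
     (\<forall>t>0. u t 0 = 0) \<and>
     (\<forall>t>0. u t 1 = (\<Sum>i=1..n. \<phi> i 1 * \<xi> i t) + integral {0..1} (\<lambda>x. k x * u t x)
                    - (\<Sum>i=1..n. \<xi> i t * integral {0..1} (\<lambda>x. \<phi> i x * k x))) \<and>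
     (\<forall>t>0. \<forall>i\<in>{1..n}. deriv (\<xi> i) t = - ((\<omega> i)\<^sup>2) * \<xi> i t + K i (L2_of (u t)))"

definition globally_exponentially_stable ::
  "real \<Rightarrow> real \<Rightarrow> (real \<Rightarrow> real) \<Rightarrow> (L2 \<Rightarrow> L2) \<Rightarrow> nat \<Rightarrow> (nat \<Rightarrow> real \<Rightarrow> real) \<Rightarrow> (nat \<Rightarrow> L2 \<Rightarrow> real) \<Rightarrow>
   (nat \<Rightarrow> real) \<Rightarrow> bool" where
  "globally_exponentially_stable p q k f n \<phi> K \<omega> \<longleftrightarrow>
     (\<exists>R>0. \<exists>\<delta>>0. \<forall>u \<xi>. closed_loop p q k f n \<phi> K \<omega> u \<xi> \<longrightarrow>
        (\<forall>t\<ge>0. norm (L2_of (u t)) + (\<Sum>i=1..n. \<bar>\<xi> i t\<bar>)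
           \<le> R * exp (- \<delta> * t) * (norm (L2_of (u 0)) + (\<Sum>i=1..n. \<bar>\<xi> i 0\<bar>))))"

definition phi_bar :: "real \<Rightarrow> real \<Rightarrow> real \<Rightarrow> real \<Rightarrow> real" where
  "phi_bar p q \<omega> x =
     (if q = \<omega>\<^sup>2 then x
      else if q < \<omega>\<^sup>2 then sin (x * sqrt (inverse p * (\<omega>\<^sup>2 - q)))
      else sinh (x * sqrt (inverse p * (q - \<omega>\<^sup>2))))"

lemma square_integrable_phi_bar: "square_integrable (phi_bar p q \<omega>)"
proof -
  consider "q = \<omega>\<^sup>2" | "q < \<omega>\<^sup>2" | "q > \<omega>\<^sup>2" by linarith
  then have "continuous_on {0..1} (phi_bar p q \<omega>)"
    by cases (auto simp: phi_bar_def[abs_def] intro!: continuous_intros)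
  then show ?thesis by (rule square_integrable_continuous)
qed

end

theory Submission
  imports Defs
begin

text \<open>
  The controller states are attached to profiles \<open>\<phi>\<^sub>i\<close> that are eigenfunctions of the
  differential operator: \<open>p \<phi>\<^sub>i'' - q \<phi>\<^sub>i = - \<omega>\<^sub>i\<^sup>2 \<phi>\<^sub>i\<close>. Hence, if \<open>\<xi>\<^sub>i\<close> decays at
  the rate \<open>\<omega>\<^sub>i\<^sup>2\<close> and is driven by \<open>K\<^sub>i(u)\<close>, the function \<open>\<xi>\<^sub>i(t) \<phi>\<^sub>i(x)\<close> solves the
  uncontrolled equation with source \<open>K\<^sub>i(u) \<phi>\<^sub>i\<close>. Subtracting all of them,
  \<open>w = u - \<Sum> \<xi>\<^sub>i \<phi>\<^sub>i\<close> solves the original equation, with the boundary feedback given by \<open>k\<close> alone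
  and with the distributed input \<open>f(u) - \<Sum> K\<^sub>i(u) \<phi>\<^sub>i\<close>
  (\<open>closed_loop_change_of_variable\<close>). Taking for \<open>\<phi>\<^sub>i\<close>, \<open>K\<^sub>i\<close>, \<open>\<omega>\<^sub>i\<close> a long enough initial segment
  of the given family makes this input as small as desired relative to \<open>u\<close>.

  What remains is a small-gain argument in the weighted quantities \<open>e\<^bsup>\<mu>t\<^esup> \<parallel>u[t]\<parallel>\<close>. Input-to-state
  stability can be restarted at any time, which turns it into an estimate of \<open>e\<^bsup>\<mu>t\<^esup> \<parallel>w[t]\<parallel>\<close> by the
  weighted size of the input, at the price of a larger but fixed gain (\<open>fading_memory\<close>). The enlarged
  gain is harmless because it is multiplied by \<open>\<epsilon>\<close>, which is still to be chosen. The controller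
  states contribute the gain
  \<open>\<Sum> P\<^sub>i \<parallel>\<phi>\<^sub>i\<parallel> / (\<omega>\<^sub>i\<^sup>2 - \<mu>)\<close> (\<open>linear_ode_fading_memory\<close>), which for small \<open>\<mu>\<close> is close to the partial sum of
  the series that is assumed to be less than one. So the total loop gain is less than one, and
  \<open>small_gain\<close> bounds \<open>e\<^bsup>\<mu>t\<^esup> \<parallel>u[t]\<parallel>\<close> by the initial data. The order of the choices matters: the
  window length \<open>T\<close>, then \<open>\<epsilon>\<close>, which fixes the number of controller states, and only then \<open>\<mu>\<close>,
  which depends on how many \<open>\<omega>\<^sub>i\<close> there are; requiring \<open>\<mu> T < 1\<close> keeps the enlarged gain independent
  of \<open>\<mu>\<close>.
\<close>

section \<open>Classes of square-integrable functions\<close>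

lemma L2_of_diff:
  assumes "square_integrable g" "square_integrable h"
  shows "L2_of (\<lambda>x. g x - h x) = L2_of g - L2_of h"
  using assms by (intro minus_L2.abs_eq[symmetric]) (auto simp: L2_rel_def)

lemma L2_of_add:
  assumes "square_integrable g" "square_integrable h"
  shows "L2_of (\<lambda>x. g x + h x) = L2_of g + L2_of h"
  using assms by (intro plus_L2.abs_eq[symmetric]) (auto simp: L2_rel_def)

lemma L2_of_scale:
  assumes "square_integrable g"
  shows "L2_of (\<lambda>x. c * g x) = c *\<^sub>R L2_of g"
  using assms by (intro scaleR_L2.abs_eq[symmetric]) (auto simp: L2_rel_def)

lemma L2_of_linear_combination:
  assumes "finite I" "\<And>i. i \<in> I \<Longrightarrow> square_integrable (g i)"
  shows "square_integrable (\<lambda>x. \<Sum>i\<in>I. c i * g i x)"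
    and "L2_of (\<lambda>x. \<Sum>i\<in>I. c i * g i x) = (\<Sum>i\<in>I. c i *\<^sub>R L2_of (g i))"
proof -
  have "square_integrable (\<lambda>x. \<Sum>i\<in>I. c i * g i x) \<and>
    L2_of (\<lambda>x. \<Sum>i\<in>I. c i * g i x) = (\<Sum>i\<in>I. c i *\<^sub>R L2_of (g i))"
    using assms
  proof (induction I rule: finite_induct)
    case empty
    then show ?case by (simp add: square_integrable_zero zero_L2_def)
  next
    case (insert i I)
    then show ?case
      by (simp add: square_integrable_add square_integrable_scale L2_of_add L2_of_scale)
  qed
  then show "square_integrable (\<lambda>x. \<Sum>i\<in>I. c i * g i x)"
    and "L2_of (\<lambda>x. \<Sum>i\<in>I. c i * g i x) = (\<Sum>i\<in>I. c i *\<^sub>R L2_of (g i))" by auto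
qed

lemma square_integrable_cong:
  assumes "\<And>x. x \<in> {0<..<1} \<Longrightarrow> g x = h x" "square_integrable g"
  shows "square_integrable h"
proof -
  have "g \<in> borel_measurable M01 \<longleftrightarrow> h \<in> borel_measurable M01"
    by (intro measurable_cong) (use assms in auto)
  moreover have "integrable M01 (\<lambda>x. (g x)\<^sup>2) \<longleftrightarrow> integrable M01 (\<lambda>x. (h x)\<^sup>2)"
    by (intro Bochner_Integration.integrable_cong) (use assms in auto)
  ultimately show ?thesis using assms by (simp add: square_integrable_def)
qed

section \<open>Regular functions on the strip\<close>

lemma C2_on_01_imp_continuous_on:
  assumes "C2_on_01 g"
  shows "continuous_on {0..1} g"
  using assms unfolding C2_on_01_def by (blast intro: DERIV_continuous_on)

lemma deriv_deriv_eq: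
  fixes g :: "real \<Rightarrow> real"
  assumes "\<And>x. x \<in> {0<..<1} \<Longrightarrow> (g has_real_derivative g' x) (at x)"
    and "\<And>x. x \<in> {0<..<1} \<Longrightarrow> (g' has_real_derivative g'' x) (at x)"
    and x: "x \<in> {0<..<1}"
  shows "(deriv ^^ 2) g x = g'' x"
proof -
  have "eventually (\<lambda>y. y \<in> {0<..<1}) (nhds x)"
    using x by (intro eventually_nhds_in_open) auto
  then have "eventually (\<lambda>y. deriv g y = g' y) (nhds x)"
    by eventually_elim (simp add: assms(1) DERIV_imp_deriv)
  then have "deriv (deriv g) x = deriv g' x" by (rule deriv_cong_ev) simp
  then show ?thesis using assms(2)[OF x] by (simp add: numeral_2_eq_2 DERIV_imp_deriv)
qed

lemma C2_on_01E:
  assumes "C2_on_01 g"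
  obtains g' g'' where
    "\<And>x. x \<in> {0..1} \<Longrightarrow> (g has_real_derivative g' x) (at x within {0..1})"
    "\<And>x. x \<in> {0..1} \<Longrightarrow> (g' has_real_derivative g'' x) (at x within {0..1})"
    "\<And>x. x \<in> {0<..<1} \<Longrightarrow> (g has_real_derivative g' x) (at x)"
    "\<And>x. x \<in> {0<..<1} \<Longrightarrow> (g' has_real_derivative g'' x) (at x)"
    "continuous_on {0..1} g''"
proof -
  obtain g' g'' where g:
    "\<And>x. x \<in> {0..1} \<Longrightarrow> (g has_real_derivative g' x) (at x within {0..1})"
    "\<And>x. x \<in> {0..1} \<Longrightarrow> (g' has_real_derivative g'' x) (at x within {0..1})"
    "continuous_on {0..1} g''"
    using assms unfolding C2_on_01_def by blast
  have interior: "x \<in> {0..1}" "at x within {0..1} = at x" if "x \<in> {0<..<1}" for x :: real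
    using that by (auto simp: interior_atLeastAtMost_real intro!: at_within_interior)
  show ?thesis
  proof (rule that[of g' g''])
    fix x :: real assume "x \<in> {0<..<1}"
    then show "(g has_real_derivative g' x) (at x)" "(g' has_real_derivative g'' x) (at x)"
      using g(1,2)[of x] interior[of x] by simp_all
  qed (use g in auto)
qed

lemma C1_differentiable_on_imp_deriv:
  fixes g :: "real \<Rightarrow> real"
  assumes "g C1_differentiable_on S"
  shows "\<And>t. t \<in> S \<Longrightarrow> (g has_real_derivative deriv g t) (at t)"
    and "continuous_on S (deriv g)"
proof -
  obtain D where D: "\<And>t. t \<in> S \<Longrightarrow> (g has_real_derivative D t) (at t)" "continuous_on S D"
    using assms
    by (auto simp: C1_differentiable_on_def has_real_derivative_iff_has_vector_derivative)
  moreover have "deriv g t = D t" if "t \<in> S" for t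
    using D(1)[OF that] by (rule DERIV_imp_deriv)
  ultimately show "\<And>t. t \<in> S \<Longrightarrow> (g has_real_derivative deriv g t) (at t)"
    and "continuous_on S (deriv g)"
    by (simp_all cong: continuous_on_cong)
qed

lemma regular_shift:
  assumes "regular u" "t0 \<ge> 0"
  shows "regular (\<lambda>t. u (t0 + t))"
proof -
  obtain ut ux where u:
    "\<And>t x. t > 0 \<Longrightarrow> x \<in> {0..1} \<Longrightarrow> ((\<lambda>s. u s x) has_real_derivative ut t x) (at t)"
    "\<And>t x. t > 0 \<Longrightarrow> x \<in> {0..1} \<Longrightarrow> (u t has_real_derivative ux t x) (at x within {0..1})"
    "continuous_on ({0<..} \<times> {0..1}) (\<lambda>(t, x). ut t x)"
    "continuous_on ({0<..} \<times> {0..1}) (\<lambda>(t, x). ux t x)"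
    using assms(1) unfolding regular_def C1_on_strip_def by blast
  have comp: "continuous_on ({0<..} \<times> {0..1}) (\<lambda>(t, x). h (t0 + t) x)"
    if "continuous_on ({0<..} \<times> {0..1}) (\<lambda>(t, x). h t x)" for h :: "real \<Rightarrow> real \<Rightarrow> real"
  proof -
    have "continuous_on ({0<..} \<times> {0..1}) (\<lambda>z. (\<lambda>(t, x). h t x) (t0 + fst z, snd z))"
      by (rule continuous_on_compose2[OF that])
        (use assms(2) in \<open>auto intro!: continuous_intros\<close>)
    then show ?thesis by (simp add: case_prod_beta)
  qed
  have "C1_on_strip (\<lambda>t. u (t0 + t))"
    unfolding C1_on_strip_def
  proof (intro exI conjI allI ballI impI)
    fix t x :: real assume "t > 0" "x \<in> {0..1}"
    then have tx: "t0 + t > 0" "x \<in> {0..1}" using assms(2) by auto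
    show "((\<lambda>s. u (t0 + s) x) has_real_derivative ut (t0 + t) x) (at t)"
      using u(1)[OF tx] unfolding add.commute[of t0] by (simp only: DERIV_shift)
    show "(u (t0 + t) has_real_derivative ux (t0 + t) x) (at x within {0..1})"
      using u(2)[OF tx] .
  qed (use comp u in auto)
  moreover have "continuous_on {0..} (\<lambda>t. L2_of (u (t0 + t)))"
    by (rule continuous_on_compose2[of "{0..}" "\<lambda>t. L2_of (u t)"])
      (use assms in \<open>auto simp: regular_def intro!: continuous_intros\<close>)
  ultimately show ?thesis using assms by (auto simp: regular_def)
qed

lemma pde_closed_loop_shift:
  assumes "pde_closed_loop p q k v u" "t0 \<ge> 0"
  shows "pde_closed_loop p q k (\<lambda>t. v (t0 + t)) (\<lambda>t. u (t0 + t))"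
proof -
  have "deriv (\<lambda>s. u (t0 + s) x) t = deriv (\<lambda>s. u s x) (t0 + t)"
    if "t > 0" "x \<in> {0<..<1}" for t x
  proof -
    have "C1_on_strip u" using assms(1) by (simp add: pde_closed_loop_def regular_def)
    moreover have "t0 + t > 0" "x \<in> {0..1}" using assms(2) that by auto
    ultimately obtain D where D: "((\<lambda>s. u s x) has_real_derivative D) (at (t0 + t))"
      unfolding C1_on_strip_def by blast
    then have "((\<lambda>s. u (t0 + s) x) has_real_derivative D) (at t)"
      unfolding add.commute[of t0] by (simp only: DERIV_shift)
    with D show ?thesis by (simp add: DERIV_imp_deriv)
  qed
  then show ?thesis
    using assms regular_shift[of u t0] by (auto simp: pde_closed_loop_def)
qed

section \<open>Eigenfunctions\<close>

lemma phi_bar_eigenfunction: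
  assumes "p > 0"
  obtains \<phi>' where "\<And>x. (phi_bar p q \<omega> has_real_derivative \<phi>' x) (at x)"
    and "\<And>x. (\<phi>' has_real_derivative (q - \<omega>\<^sup>2) / p * phi_bar p q \<omega> x) (at x)"
proof -
  consider "q = \<omega>\<^sup>2" | "q < \<omega>\<^sup>2" | "q > \<omega>\<^sup>2" by linarith
  then show ?thesis
  proof cases
    case 1
    then have "phi_bar p q \<omega> = (\<lambda>x. x)" by (auto simp: phi_bar_def)
    with 1 show ?thesis by (intro that[of "\<lambda>x. 1"]) (auto intro!: derivative_eq_intros)
  next
    case 2
    define r where "r = sqrt (inverse p * (\<omega>\<^sup>2 - q))"
    have r: "(q - \<omega>\<^sup>2) / p = - r * r"
      using 2 assms by (simp add: r_def field_simps)
    have eq: "phi_bar p q \<omega> = (\<lambda>x. sin (x * r))" using 2 by (auto simp: phi_bar_def r_def)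
    show ?thesis
      by (rule that[of "\<lambda>x. r * cos (x * r)"]; unfold eq r) (auto intro!: derivative_eq_intros)
  next
    case 3
    define r where "r = sqrt (inverse p * (q - \<omega>\<^sup>2))"
    have r: "(q - \<omega>\<^sup>2) / p = r * r"
      using 3 assms by (simp add: r_def field_simps)
    have eq: "phi_bar p q \<omega> = (\<lambda>x. sinh (x * r))" using 3 by (auto simp: phi_bar_def r_def)
    show ?thesis
      by (rule that[of "\<lambda>x. r * cosh (x * r)"]; unfold eq r) (auto intro!: derivative_eq_intros)
  qed
qed

lemma C2_on_01_phi_bar:
  assumes "p > 0"
  shows "C2_on_01 (phi_bar p q \<omega>)"
proof -
  obtain \<phi>' where \<phi>': "\<And>x. (phi_bar p q \<omega> has_real_derivative \<phi>' x) (at x)"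
    "\<And>x. (\<phi>' has_real_derivative (q - \<omega>\<^sup>2) / p * phi_bar p q \<omega> x) (at x)"
    using phi_bar_eigenfunction[OF assms] by blast
  have cont: "continuous_on {0..1} (phi_bar p q \<omega>)"
    using \<phi>'(1) by (intro DERIV_continuous_on) (blast intro: has_field_derivative_at_within)
  show ?thesis
    unfolding C2_on_01_def
    by (rule exI[of _ \<phi>'], rule exI[of _ "\<lambda>x. (q - \<omega>\<^sup>2) / p * phi_bar p q \<omega> x"])
      (intro conjI ballI has_field_derivative_at_within[OF \<phi>'(1)]
        has_field_derivative_at_within[OF \<phi>'(2)] continuous_on_mult_left cont)
qed

lemma phi_bar_0: "phi_bar p q \<omega> 0 = 0"
  by (simp add: phi_bar_def)

section \<open>Removing the controller states\<close>

text \<open>The eigenfunction equation turns the decay terms \<open>\<omega>\<^sub>i\<^sup>2 \<xi>\<^sub>i \<phi>\<^sub>i\<close> into the differential operator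
  applied to \<open>\<xi>\<^sub>i \<phi>\<^sub>i\<close>, so that only the driving terms survive as a distributed input. The boundary
  condition at \<open>1\<close> is designed so that the controller states cancel there too.\<close>

lemma closed_loop_change_of_variable:
  assumes cl: "closed_loop p q k f n \<phi> K \<omega> u \<xi>"
    and "p \<noteq> 0" and k: "continuous_on {0..1} k"
    and \<phi>: "\<And>i x. (\<phi> i has_real_derivative \<phi>' i x) (at x)"
    and \<phi>': "\<And>i x. (\<phi>' i has_real_derivative (q - (\<omega> i)\<^sup>2) / p * \<phi> i x) (at x)"
    and \<phi>0: "\<And>i. \<phi> i 0 = 0"
  defines "w \<equiv> \<lambda>t x. u t x - (\<Sum>i=1..n. \<xi> i t * \<phi> i x)"
  obtains v where
    "\<And>t. t \<ge> 0 \<Longrightarrow> square_integrable (v t)"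
    "\<And>t. t \<ge> 0 \<Longrightarrow>
      L2_of (v t) = f (L2_of (u t)) - (\<Sum>i=1..n. K i (L2_of (u t)) *\<^sub>R L2_of (\<phi> i))"
    "pde_closed_loop p q k v w"
    "\<And>t. t \<ge> 0 \<Longrightarrow> L2_of (w t) = L2_of (u t) - (\<Sum>i=1..n. \<xi> i t *\<^sub>R L2_of (\<phi> i))"
proof -
  have c\<phi>: "continuous_on A (\<phi> i)" and c\<phi>': "continuous_on A (\<phi>' i)" for i A
    by (rule DERIV_continuous_on, rule has_field_derivative_at_within, rule \<phi> \<phi>')+
  note s\<phi> = square_integrable_continuous[OF c\<phi>]
  have regu: "regular u" using cl by (simp add: closed_loop_def)
  obtain ut ux where u:
    "\<And>t x. t > 0 \<Longrightarrow> x \<in> {0..1} \<Longrightarrow> ((\<lambda>s. u s x) has_real_derivative ut t x) (at t)"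
    "\<And>t x. t > 0 \<Longrightarrow> x \<in> {0..1} \<Longrightarrow> (u t has_real_derivative ux t x) (at x within {0..1})"
    "continuous_on ({0<..} \<times> {0..1}) (\<lambda>(t, x). ut t x)"
    "continuous_on ({0<..} \<times> {0..1}) (\<lambda>(t, x). ux t x)"
    using regu unfolding regular_def C1_on_strip_def by blast
  define \<xi>' where "\<xi>' i = deriv (\<xi> i)" for i
  have "\<xi> i C1_differentiable_on {0<..}" if "i \<in> {1..n}" for i
    using cl that by (simp add: closed_loop_def)
  then have \<xi>: "\<And>i t. i \<in> {1..n} \<Longrightarrow> t > 0 \<Longrightarrow> (\<xi> i has_real_derivative \<xi>' i t) (at t)"
    and c\<xi>': "\<And>i. i \<in> {1..n} \<Longrightarrow> continuous_on {0<..} (\<xi>' i)"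
    unfolding \<xi>'_def by (auto intro: C1_differentiable_on_imp_deriv)
  have c\<xi>: "continuous_on {0..} (\<xi> i)" if "i \<in> {1..n}" for i
    using cl that by (auto simp: closed_loop_def)
  have \<xi>'_eq: "\<xi>' i t = - ((\<omega> i)\<^sup>2) * \<xi> i t + K i (L2_of (u t))" if "i \<in> {1..n}" "t > 0" for i t
    using cl that by (simp add: closed_loop_def \<xi>'_def)
  have wt: "((\<lambda>s. w s x) has_real_derivative ut t x - (\<Sum>i=1..n. \<xi>' i t * \<phi> i x)) (at t)"
    if "t > 0" "x \<in> {0..1}" for t x
    unfolding w_def by (auto intro!: derivative_eq_intros u \<xi> that)
  have wx: "(w t has_real_derivative ux t x - (\<Sum>i=1..n. \<xi> i t * \<phi>' i x)) (at x within {0..1})"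
    if "t > 0" "x \<in> {0..1}" for t x
    unfolding w_def
    by (auto intro!: derivative_eq_intros u that \<phi>[THEN has_field_derivative_at_within]
        simp: mult.commute)
  have squ: "square_integrable (u t)" if "t \<ge> 0" for t using regu that by (auto simp: regular_def)
  have w_L2: "L2_of (w t) = L2_of (u t) - (\<Sum>i=1..n. \<xi> i t *\<^sub>R L2_of (\<phi> i))"
    and squ_w: "square_integrable (w t)" if "t \<ge> 0" for t
    unfolding w_def using squ[OF that] s\<phi>
    by (simp_all add: L2_of_diff L2_of_linear_combination square_integrable_diff)
  have cfst: "continuous_on ({0<..} \<times> {0..1}) (\<lambda>z. h (fst z))" if "continuous_on {0<..} h"
    for h :: "real \<Rightarrow> real"
    by (rule continuous_on_compose2[OF that]) (auto intro!: continuous_intros)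
  have csnd: "continuous_on ({0<..} \<times> {0..1}) (\<lambda>z. h (snd z))" if "continuous_on UNIV h"
    for h :: "real \<Rightarrow> real"
    by (rule continuous_on_compose2[OF that]) (auto intro!: continuous_intros)
  have C1: "C1_on_strip w"
    unfolding C1_on_strip_def
  proof (intro exI conjI allI ballI impI)
    have "continuous_on ({0<..} \<times> {0..1})
        (\<lambda>z. (case z of (t, x) \<Rightarrow> ut t x) - (\<Sum>i=1..n. \<xi>' i (fst z) * \<phi> i (snd z)))"
      by (intro continuous_intros u cfst csnd c\<phi> c\<xi>')
    then show "continuous_on ({0<..} \<times> {0..1}) (\<lambda>(t, x). ut t x - (\<Sum>i=1..n. \<xi>' i t * \<phi> i x))"
      by (simp add: case_prod_beta)
    have "continuous_on ({0<..} \<times> {0..1})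
        (\<lambda>z. (case z of (t, x) \<Rightarrow> ux t x) - (\<Sum>i=1..n. \<xi> i (fst z) * \<phi>' i (snd z)))"
      by (intro continuous_intros u cfst csnd c\<phi>' continuous_on_subset[OF c\<xi>]) auto
    then show "continuous_on ({0<..} \<times> {0..1}) (\<lambda>(t, x). ux t x - (\<Sum>i=1..n. \<xi> i t * \<phi>' i x))"
      by (simp add: case_prod_beta)
  qed (use wt wx in auto)
  have C2: "C2_on_01 (w t)"
    and w_xx: "\<And>x. x \<in> {0<..<1} \<Longrightarrow>
      (deriv ^^ 2) (w t) x = (deriv ^^ 2) (u t) x - (\<Sum>i=1..n. \<xi> i t * ((q - (\<omega> i)\<^sup>2) / p * \<phi> i x))"
    if t: "t > 0" for t
  proof -
    have "C2_on_01 (u t)" using regu t by (auto simp: regular_def)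
    then obtain g' g'' where g:
      "\<And>x. x \<in> {0..1} \<Longrightarrow> (u t has_real_derivative g' x) (at x within {0..1})"
      "\<And>x. x \<in> {0..1} \<Longrightarrow> (g' has_real_derivative g'' x) (at x within {0..1})"
      "\<And>x. x \<in> {0<..<1} \<Longrightarrow> (u t has_real_derivative g' x) (at x)"
      "\<And>x. x \<in> {0<..<1} \<Longrightarrow> (g' has_real_derivative g'' x) (at x)"
      "continuous_on {0..1} g''"
      by (rule C2_on_01E) blast
    show "C2_on_01 (w t)"
      unfolding C2_on_01_def w_def
      by (rule exI[of _ "\<lambda>x. g' x - (\<Sum>i=1..n. \<xi> i t * \<phi>' i x)"],
          rule exI[of _ "\<lambda>x. g'' x - (\<Sum>i=1..n. \<xi> i t * ((q - (\<omega> i)\<^sup>2) / p * \<phi> i x))"])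
        (intro conjI ballI DERIV_diff DERIV_sum DERIV_cmult g continuous_intros c\<phi>
          \<phi>[THEN has_field_derivative_at_within] \<phi>'[THEN has_field_derivative_at_within];
         use \<open>p \<noteq> 0\<close> in simp)
    fix x :: real assume x: "x \<in> {0<..<1}"
    have "(deriv ^^ 2) (w t) x = g'' x - (\<Sum>i=1..n. \<xi> i t * ((q - (\<omega> i)\<^sup>2) / p * \<phi> i x))"
      unfolding w_def
      by (rule deriv_deriv_eq[OF _ _ x, where g' = "\<lambda>x. g' x - (\<Sum>i=1..n. \<xi> i t * \<phi>' i x)"];
          intro DERIV_diff DERIV_sum DERIV_cmult g \<phi> \<phi>'; assumption)
    moreover have "(deriv ^^ 2) (u t) x = g'' x"
      by (rule deriv_deriv_eq[OF g(3,4) x])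
    ultimately show "(deriv ^^ 2) (w t) x
        = (deriv ^^ 2) (u t) x - (\<Sum>i=1..n. \<xi> i t * ((q - (\<omega> i)\<^sup>2) / p * \<phi> i x))" by simp
  qed
  have "continuous_on {0..} (\<lambda>t. L2_of (u t) - (\<Sum>i=1..n. \<xi> i t *\<^sub>R L2_of (\<phi> i)))"
    using regu by (intro continuous_intros c\<xi>) (auto simp: regular_def)
  then have "continuous_on {0..} (\<lambda>t. L2_of (w t))"
    using w_L2 by (subst continuous_on_cong[OF refl]) auto
  then have regw: "regular w" using C1 C2 squ_w by (auto simp: regular_def)
  \<comment> \<open>The equation for \<open>u\<close> holds almost everywhere, but the one for \<open>w\<close> has to hold at every interior
    point. So for positive times the input is defined as the residual of \<open>w\<close>, and it is afterwards
    identified with the class of \<open>F t\<close>. At time zero there is no equation to take a residual of.\<close>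
  define v where "v t x = (if t > 0
      then deriv (\<lambda>s. w s x) t - p * (deriv ^^ 2) (w t) x + q * w t x
      else rep_L2 (f (L2_of (u t))) x - (\<Sum>i=1..n. K i (L2_of (u t)) * \<phi> i x))" for t x
  define F where "F t x = rep_L2 (f (L2_of (u t))) x - (\<Sum>i=1..n. K i (L2_of (u t)) * \<phi> i x)" for t x
  have squ_F: "square_integrable (F t)"
    and L2_F: "L2_of (F t) = f (L2_of (u t)) - (\<Sum>i=1..n. K i (L2_of (u t)) *\<^sub>R L2_of (\<phi> i))" for t
    unfolding F_def
    by (simp_all add: L2_of_diff L2_of_linear_combination square_integrable_diff
        square_integrable_rep_L2 L2_of_rep_L2 s\<phi>)
  have v_eq: "v t x = ut t x - p * (deriv ^^ 2) (u t) x + q * u t x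
      - (\<Sum>i=1..n. K i (L2_of (u t)) * \<phi> i x)" if "t > 0" "x \<in> {0<..<1}" for t x
  proof -
    have x: "x \<in> {0..1}" using that by auto
    have "v t x = ut t x - (\<Sum>i=1..n. \<xi>' i t * \<phi> i x)
        - p * ((deriv ^^ 2) (u t) x - (\<Sum>i=1..n. \<xi> i t * ((q - (\<omega> i)\<^sup>2) / p * \<phi> i x)))
        + q * (u t x - (\<Sum>i=1..n. \<xi> i t * \<phi> i x))"
      using that DERIV_imp_deriv[OF wt[OF that(1) x]] w_xx[OF that] by (simp add: v_def w_def)
    also have "\<dots> = ut t x - p * (deriv ^^ 2) (u t) x + q * u t x
        - (\<Sum>i=1..n. \<xi>' i t * \<phi> i x - p * (\<xi> i t * ((q - (\<omega> i)\<^sup>2) / p * \<phi> i x)) + q * (\<xi> i t * \<phi> i x))"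
      by (simp add: sum.distrib sum_subtractf sum_distrib_left algebra_simps)
    also have "(\<Sum>i=1..n. \<xi>' i t * \<phi> i x - p * (\<xi> i t * ((q - (\<omega> i)\<^sup>2) / p * \<phi> i x)) + q * (\<xi> i t * \<phi> i x))
        = (\<Sum>i=1..n. K i (L2_of (u t)) * \<phi> i x)"
      using that \<open>p \<noteq> 0\<close> by (intro sum.cong refl) (simp add: \<xi>'_eq field_simps)
    finally show ?thesis .
  qed
  have squ_v: "square_integrable (v t)" if t: "t > 0" for t
  proof -
    have "C2_on_01 (u t)" using regu t by (auto simp: regular_def)
    then obtain g' g'' where g:
      "\<And>x. x \<in> {0<..<1} \<Longrightarrow> (u t has_real_derivative g' x) (at x)"
      "\<And>x. x \<in> {0<..<1} \<Longrightarrow> (g' has_real_derivative g'' x) (at x)"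
      "continuous_on {0..1} g''"
      by (rule C2_on_01E) blast
    have "continuous_on {0..1} (u t)"
      using \<open>C2_on_01 (u t)\<close> by (rule C2_on_01_imp_continuous_on)
    moreover have "continuous_on {0..1} (\<lambda>x. (\<lambda>(t, x). ut t x) (t, x))"
      by (rule continuous_on_compose2[OF u(3)]) (use t in \<open>auto intro!: continuous_intros\<close>)
    ultimately have "continuous_on {0..1} (\<lambda>x. ut t x - p * g'' x + q * u t x
        - (\<Sum>i=1..n. K i (L2_of (u t)) * \<phi> i x))"
      by (intro continuous_intros g c\<phi>) auto
    moreover have "(deriv ^^ 2) (u t) x = g'' x" if "x \<in> {0<..<1}" for x
      by (rule deriv_deriv_eq[OF g(1,2) that])
    ultimately show ?thesis
      by (elim square_integrable_cong[rotated, OF square_integrable_continuous])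
        (simp add: v_eq[OF t])
  qed
  have v_L2: "L2_of (v t) = L2_of (F t)" if t: "t > 0" for t
  proof -
    have "AE x in M01. deriv (\<lambda>s. u s x) t
        = p * (deriv ^^ 2) (u t) x - q * u t x + rep_L2 (f (L2_of (u t))) x"
      using cl t by (simp add: closed_loop_def)
    moreover have "AE x in M01. x \<in> {0<..<1}"
      using AE_space[of M01] by simp
    ultimately have "AE x in M01. v t x = F t x"
    proof eventually_elim
      case (elim x)
      then have "deriv (\<lambda>s. u s x) t = ut t x"
        using t by (intro DERIV_imp_deriv u) auto
      with elim show ?case by (simp add: v_eq[OF t] F_def)
    qed
    then show ?thesis using squ_v[OF t] squ_F by (simp add: L2_of_eq_iff)
  qed
  have v0: "v t = F t" if "t \<le> 0" for t using that by (auto simp: v_def F_def)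
  have bdry: "w t 1 = integral {0..1} (\<lambda>x. k x * w t x)" if t: "t > 0" for t
  proof -
    have "continuous_on {0..1} (u t)"
      using regu t by (intro C2_on_01_imp_continuous_on) (auto simp: regular_def)
    then have "(\<lambda>x. k x * u t x) integrable_on {0..1}"
      by (intro integrable_continuous_real continuous_intros k)
    moreover have int\<phi>: "(\<lambda>x. \<phi> i x * k x) integrable_on {0..1}" for i
      by (intro integrable_continuous_real continuous_intros k c\<phi>)
    ultimately have "((\<lambda>x. k x * u t x - (\<Sum>i=1..n. \<xi> i t * (\<phi> i x * k x))) has_integral
        integral {0..1} (\<lambda>x. k x * u t x) - (\<Sum>i=1..n. \<xi> i t * integral {0..1} (\<lambda>x. \<phi> i x * k x))) {0..1}"
      by (intro has_integral_diff has_integral_sum has_integral_mult_right integrable_integral) auto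
    note integral_unique[OF this]
    moreover have "k x * w t x = k x * u t x - (\<Sum>i=1..n. \<xi> i t * (\<phi> i x * k x))" for x
      by (simp add: w_def algebra_simps sum_distrib_left)
    moreover have "u t 1 = (\<Sum>i=1..n. \<phi> i 1 * \<xi> i t) + integral {0..1} (\<lambda>x. k x * u t x)
        - (\<Sum>i=1..n. \<xi> i t * integral {0..1} (\<lambda>x. \<phi> i x * k x))"
      using cl t by (simp add: closed_loop_def)
    ultimately show ?thesis by (simp add: w_def mult.commute)
  qed
  have "pde_closed_loop p q k v w"
    unfolding pde_closed_loop_def
  proof (intro conjI allI impI ballI)
    fix t :: real assume t: "t > 0"
    show "w t 0 = 0" using cl t by (simp add: w_def closed_loop_def \<phi>0)
    show "w t 1 = integral {0..1} (\<lambda>x. k x * w t x)" using bdry[OF t] .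
    show "deriv (\<lambda>s. w s x) t = p * (deriv ^^ 2) (w t) x - q * w t x + v t x" for x
      using t by (simp add: v_def)
  qed (rule regw)
  moreover have "square_integrable (v t)" "L2_of (v t) = L2_of (F t)" for t
    using v0[of t] squ_v[of t] squ_F[of t] v_L2[of t] by (cases "t > 0"; simp)+
  ultimately show ?thesis using w_L2 L2_F by (intro that[of v]) auto
qed

section \<open>Estimates with fading memory\<close>

text \<open>The equation is autonomous, so the estimate may be started at any time \<open>t0\<close>; the past of the
  input before \<open>t0\<close> then enters only through the state at \<open>t0\<close>. A finite bound \<open>B\<close> also removes the
  extended reals.\<close>

lemma ISS_from_time:
  assumes "\<And>v u t. (\<forall>t\<ge>0. square_integrable (v t)) \<Longrightarrow> pde_closed_loop p q k v u \<Longrightarrow> t \<ge> 0 \<Longrightarrow>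
        ennreal (norm (L2_of (u t)))
           \<le> ennreal (G * exp (- \<sigma> * t) * norm (L2_of (u 0)))
             + ennreal g * (SUP s\<in>{0..t}. ennreal (norm (L2_of (v s))))"
    and "G \<ge> 0" "g \<ge> 0" "t0 \<ge> 0" "t \<ge> 0"
    and v: "\<And>t. t \<ge> 0 \<Longrightarrow> square_integrable (v t)" and pde: "pde_closed_loop p q k v w"
    and B: "\<And>s. s \<in> {t0..t0 + t} \<Longrightarrow> norm (L2_of (v s)) \<le> B"
  shows "norm (L2_of (w (t0 + t))) \<le> G * exp (- \<sigma> * t) * norm (L2_of (w t0)) + g * B"
proof -
  have "norm (L2_of (v t0)) \<le> B" using \<open>t \<ge> 0\<close> by (intro B) auto
  then have "B \<ge> 0" using norm_ge_zero order_trans by blast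
  have "(SUP s\<in>{0..t}. ennreal (norm (L2_of (v (t0 + s))))) \<le> ennreal B"
    by (intro SUP_least ennreal_leI B) auto
  then have "ennreal g * (SUP s\<in>{0..t}. ennreal (norm (L2_of (v (t0 + s))))) \<le> ennreal g * ennreal B"
    by (intro mult_left_mono) auto
  moreover have "ennreal (norm (L2_of (w (t0 + t))))
      \<le> ennreal (G * exp (- \<sigma> * t) * norm (L2_of (w t0)))
        + ennreal g * (SUP s\<in>{0..t}. ennreal (norm (L2_of (v (t0 + s)))))"
    using assms(1)[of "\<lambda>t. v (t0 + t)" "\<lambda>t. w (t0 + t)" t] assms(4,5) v
      pde_closed_loop_shift[OF pde \<open>t0 \<ge> 0\<close>] by simp
  ultimately have "ennreal (norm (L2_of (w (t0 + t))))
      \<le> ennreal (G * exp (- \<sigma> * t) * norm (L2_of (w t0))) + ennreal g * ennreal B"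
    by (meson add_left_mono order_trans)
  also have "\<dots> = ennreal (G * exp (- \<sigma> * t) * norm (L2_of (w t0)) + g * B)"
    using assms(2,3) \<open>B \<ge> 0\<close> by (simp add: ennreal_mult ennreal_plus)
  finally show ?thesis
    using assms(2,3) \<open>B \<ge> 0\<close> by (subst (asm) ennreal_le_iff) auto
qed

text \<open>Over a window of length \<open>T\<close> the contribution of the initial state is halved even after weighting
  with \<open>e\<^bsup>\<mu>t\<^esup>\<close>, while the weight varies by at most the factor \<open>e\<^bsup>\<mu>T\<^esup>\<close>. Going from window to window, the
  bound \<open>2 b\<close> with \<open>b = e\<^bsup>\<mu>T\<^esup> (G y(0) + g D)\<close> reproduces itself, since \<open>2 b / 2 + b = 2 b\<close>.\<close>

lemma fading_memory:
  fixes y d :: "real \<Rightarrow> real"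
  assumes iss: "\<And>t0 t B. t0 \<ge> 0 \<Longrightarrow> t \<ge> 0 \<Longrightarrow> (\<And>s. s \<in> {t0..t0 + t} \<Longrightarrow> d s \<le> B) \<Longrightarrow>
      y (t0 + t) \<le> G * exp (- \<sigma> * t) * y t0 + g * B"
    and G: "G \<ge> 0" and g: "g \<ge> 0" and \<sigma>: "\<sigma> \<ge> 0" and y: "\<And>t. y t \<ge> 0" and \<mu>: "\<mu> \<ge> 0"
    and T: "T > 0" "G * exp (- (\<sigma> - \<mu>) * T) \<le> 1 / 2"
    and D: "\<And>s. s \<in> {0..t} \<Longrightarrow> exp (\<mu> * s) * d s \<le> D" "D \<ge> 0" and t: "t \<ge> 0"
  shows "exp (\<mu> * t) * y t \<le> 2 * exp (\<mu> * T) * (G * y 0 + g * D)"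
proof -
  have "exp (\<mu> * s) * y s \<le> 2 * exp (\<mu> * T) * (G * y 0 + g * D)"
    if "0 \<le> s" "s \<le> t" "s < real m * T" for s m
    using that
  proof (induction m arbitrary: s)
    case 0
    then show ?case by simp
  next
    case (Suc m)
    have d: "d r \<le> exp (- \<mu> * a) * D" if "a \<le> r" "0 \<le> r" "r \<le> t" for a r
    proof -
      have "d r \<le> exp (- \<mu> * r) * D"
        using D(1)[of r] that by (simp add: exp_minus field_simps)
      also have "\<dots> \<le> exp (- \<mu> * a) * D"
        using that \<mu> D(2) by (intro mult_right_mono) (auto intro!: mult_left_mono)
      finally show ?thesis .
    qed
    show ?case
    proof (cases "s < T")
      case True
      have "y (0 + s) \<le> G * exp (- \<sigma> * s) * y 0 + g * (exp (- \<mu> * 0) * D)"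
        using Suc.prems by (intro iss d) auto
      also have "\<dots> \<le> G * 1 * y 0 + g * D"
        using Suc.prems G g \<sigma> y by (intro add_mono mult_right_mono mult_left_mono) auto
      finally have "exp (\<mu> * s) * y s \<le> exp (\<mu> * T) * (G * y 0 + g * D)"
        using True \<mu> y by (intro mult_mono) (auto intro!: mult_left_mono)
      also have "\<dots> \<le> 2 * exp (\<mu> * T) * (G * y 0 + g * D)"
        using G g y D by auto
      finally show ?thesis .
    next
      case False
      define a where "a = s - T"
      have a: "a \<ge> 0" "a \<le> t" "a < real m * T" "s = a + T"
        using False Suc.prems T by (auto simp: a_def algebra_simps)
      have "y (a + T) \<le> G * exp (- \<sigma> * T) * y a + g * (exp (- \<mu> * a) * D)"
        using a T Suc.prems by (intro iss d) auto
      then have "exp (\<mu> * s) * y s \<le> exp (\<mu> * s) * (G * exp (- \<sigma> * T) * y a + g * (exp (- \<mu> * a) * D))"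
        using a by simp
      also have "\<dots> = G * exp (- (\<sigma> - \<mu>) * T) * (exp (\<mu> * a) * y a) + exp (\<mu> * T) * (g * D)"
        by (simp add: a(4) exp_minus exp_diff exp_add field_simps)
      also have "\<dots> \<le> 1 / 2 * (2 * exp (\<mu> * T) * (G * y 0 + g * D)) + exp (\<mu> * T) * (g * D)"
        using a y T by (intro add_mono mult_mono Suc.IH order_refl) auto
      also have "\<dots> \<le> 2 * exp (\<mu> * T) * (G * y 0 + g * D)"
        using G y by (simp add: algebra_simps)
      finally show ?thesis .
    qed
  qed
  moreover obtain m where "t < real m * T"
    using reals_Archimedean3[OF T(1)] by blast
  ultimately show ?thesis using t by blast
qed

text \<open>By variation of constants; the integral is replaced by comparing \<open>e\<^bsup>as\<^esup> \<xi>(s)\<close> with a multiple of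
  \<open>e\<^bsup>(a - \<mu>)s\<^esup>\<close>, whose derivative dominates. This asks for the equation only inside the interval.\<close>

lemma linear_ode_fading_memory:
  fixes \<xi> \<kappa> :: "real \<Rightarrow> real"
  assumes cont: "continuous_on {0..t} \<xi>"
    and ode: "\<And>s. 0 < s \<Longrightarrow> s < t \<Longrightarrow> (\<xi> has_real_derivative - a * \<xi> s + \<kappa> s) (at s)"
    and \<kappa>: "\<And>s. 0 < s \<Longrightarrow> s < t \<Longrightarrow> exp (\<mu> * s) * \<bar>\<kappa> s\<bar> \<le> C"
    and C: "C \<ge> 0" and \<mu>: "\<mu> < a" and t: "t \<ge> 0"
  shows "exp (\<mu> * t) * \<bar>\<xi> t\<bar> \<le> \<bar>\<xi> 0\<bar> + C / (a - \<mu>)"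
proof (cases "t = 0")
  case True
  then show ?thesis using C \<mu> by simp
next
  case False
  then have t: "t > 0" using t by simp
  define h where "h s = exp (a * s) * \<xi> s" for s
  define H where "H s = C / (a - \<mu>) * exp ((a - \<mu>) * s)" for s
  have "norm (h t - h 0) \<le> H t - H 0"
  proof (rule differentiable_bound_general[OF t])
    show "continuous_on {0..t} h" "continuous_on {0..t} H"
      unfolding h_def H_def by (intro continuous_intros cont)+
    fix s assume s: "0 < s" "s < t"
    have "(h has_real_derivative exp (a * s) * \<kappa> s) (at s)"
      unfolding h_def by (auto intro!: derivative_eq_intros ode s simp: algebra_simps)
    then show "(h has_vector_derivative exp (a * s) * \<kappa> s) (at s)"
      by (simp add: has_real_derivative_iff_has_vector_derivative)
    have "(H has_real_derivative C * exp ((a - \<mu>) * s)) (at s)"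
      unfolding H_def using \<mu> by (auto intro!: derivative_eq_intros)
    then show "(H has_vector_derivative C * exp ((a - \<mu>) * s)) (at s)"
      by (simp add: has_real_derivative_iff_has_vector_derivative)
    have "norm (exp (a * s) * \<kappa> s) = exp ((a - \<mu>) * s) * (exp (\<mu> * s) * \<bar>\<kappa> s\<bar>)"
      by (simp add: abs_mult left_diff_distrib exp_diff)
    also have "\<dots> \<le> exp ((a - \<mu>) * s) * C" using \<kappa>[OF s] by (intro mult_left_mono) auto
    finally show "norm (exp (a * s) * \<kappa> s) \<le> C * exp ((a - \<mu>) * s)" by (simp add: mult.commute)
  qed
  moreover have "H 0 \<ge> 0" using C \<mu> by (simp add: H_def)
  ultimately have "\<bar>h t\<bar> \<le> \<bar>h 0\<bar> + H t" by simp
  then have "exp (- (a - \<mu>) * t) * \<bar>h t\<bar> \<le> exp (- (a - \<mu>) * t) * (\<bar>h 0\<bar> + H t)"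
    by (intro mult_left_mono) auto
  also have "\<dots> = exp (- (a - \<mu>) * t) * \<bar>\<xi> 0\<bar> + C / (a - \<mu>)"
    by (simp add: h_def H_def distrib_left mult.left_commute flip: exp_add) (simp add: algebra_simps)
  also have "\<dots> \<le> 1 * \<bar>\<xi> 0\<bar> + C / (a - \<mu>)"
    using \<mu> t by (intro add_mono mult_right_mono) (auto intro!: mult_nonpos_nonneg)
  also have "exp (- (a - \<mu>) * t) * \<bar>h t\<bar> = exp (\<mu> * t) * \<bar>\<xi> t\<bar>"
    by (simp add: h_def abs_mult algebra_simps flip: exp_add mult.assoc)
  finally show ?thesis by simp
qed

text \<open>\<open>U\<close> is compared with its own maximum on \<open>[0, t]\<close>, which is finite by continuity: at the point where it is
  attained, all but the fraction \<open>\<eta>\<close> of it can be absorbed.\<close>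

lemma small_gain:
  fixes U W :: "real \<Rightarrow> real" and X :: "'i \<Rightarrow> real \<Rightarrow> real"
  assumes "continuous_on {0..} U" and U: "\<And>t. U t \<ge> 0"
    and split: "\<And>t. t \<ge> 0 \<Longrightarrow> U t \<le> W t + (\<Sum>i\<in>I. c i * X i t)"
    and W: "\<And>t D. t \<ge> 0 \<Longrightarrow> D \<ge> 0 \<Longrightarrow> (\<And>s. s \<in> {0..t} \<Longrightarrow> U s \<le> D) \<Longrightarrow> W t \<le> A + \<alpha> * D"
    and X: "\<And>t D i. t \<ge> 0 \<Longrightarrow> D \<ge> 0 \<Longrightarrow> (\<And>s. s \<in> {0..t} \<Longrightarrow> U s \<le> D) \<Longrightarrow> i \<in> I \<Longrightarrow>
      X i t \<le> x\<^sub>0 i + \<beta> i * D"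
    and c: "\<And>i. i \<in> I \<Longrightarrow> c i \<ge> 0"
    and gain: "\<alpha> + (\<Sum>i\<in>I. c i * \<beta> i) \<le> 1 - \<eta>" "\<eta> > 0" and t: "t \<ge> 0"
  shows "U t \<le> (A + (\<Sum>i\<in>I. c i * x\<^sub>0 i)) / \<eta>"
proof -
  have "continuous_on {0..t} U" using assms(1) by (rule continuous_on_subset) auto
  then obtain r where r: "r \<in> {0..t}" "\<And>s. s \<in> {0..t} \<Longrightarrow> U s \<le> U r"
    using continuous_attains_sup[of "{0..t}" U] t by auto
  have "U r \<le> W r + (\<Sum>i\<in>I. c i * X i r)" using split r by simp
  also have "\<dots> \<le> (A + \<alpha> * U r) + (\<Sum>i\<in>I. c i * (x\<^sub>0 i + \<beta> i * U r))"
    using r U by (intro add_mono sum_mono mult_left_mono W X c) auto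
  also have "\<dots> = A + (\<Sum>i\<in>I. c i * x\<^sub>0 i) + (\<alpha> + (\<Sum>i\<in>I. c i * \<beta> i)) * U r"
    by (simp add: distrib_left distrib_right sum.distrib sum_distrib_right mult.assoc)
  also have "\<dots> \<le> A + (\<Sum>i\<in>I. c i * x\<^sub>0 i) + (1 - \<eta>) * U r"
    using gain U by (intro add_mono mult_right_mono) auto
  finally have "U r * \<eta> \<le> A + (\<Sum>i\<in>I. c i * x\<^sub>0 i)" by (simp add: algebra_simps)
  then have "U r \<le> (A + (\<Sum>i\<in>I. c i * x\<^sub>0 i)) / \<eta>" using gain(2) by (simp add: pos_le_divide_eq)
  then show ?thesis using r(2)[of t] t by simp
qed

text \<open>A strict bound on the gain without weights survives a small positive decay rate, because
  the sum is finite and each of its terms is continuous in the rate near zero.\<close>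

lemma small_decay_rate:
  fixes b c :: "'i \<Rightarrow> real"
  assumes "finite I" "\<And>i. i \<in> I \<Longrightarrow> b i > 0" "(\<Sum>i\<in>I. c i / b i) < \<theta>" "m > 0"
  obtains \<mu> where "\<mu> > 0" "\<mu> < m" "\<And>i. i \<in> I \<Longrightarrow> \<mu> < b i" "(\<Sum>i\<in>I. c i / (b i - \<mu>)) < \<theta>"
proof -
  have lim: "((\<lambda>\<mu>. \<mu>) \<longlongrightarrow> (0::real)) (at_right 0)" by (rule tendsto_ident_at)
  have "((\<lambda>\<mu>. \<Sum>i\<in>I. c i / (b i - \<mu>)) \<longlongrightarrow> (\<Sum>i\<in>I. c i / (b i - 0))) (at_right 0)"
    using assms(2) by (intro tendsto_intros lim) force
  then have "eventually (\<lambda>\<mu>. (\<Sum>i\<in>I. c i / (b i - \<mu>)) < \<theta>) (at_right 0)"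
    using assms(3) by (intro order_tendstoD(2)) auto
  moreover have "eventually (\<lambda>\<mu>. \<forall>i\<in>I. \<mu> < b i) (at_right 0)"
    using assms(1,2) order_tendstoD(2)[OF lim] by (simp add: eventually_ball_finite_distrib)
  moreover have "eventually (\<lambda>\<mu>. \<mu> < m) (at_right 0)" using order_tendstoD(2)[OF lim \<open>m > 0\<close>] .
  moreover have "eventually (\<lambda>\<mu>::real. \<mu> > 0) (at_right 0)" by (rule eventually_at_right_less)
  ultimately have "eventually (\<lambda>\<mu>. \<mu> > 0 \<and> \<mu> < m \<and> (\<forall>i\<in>I. \<mu> < b i) \<and>
      (\<Sum>i\<in>I. c i / (b i - \<mu>)) < \<theta>) (at_right 0)"
    by eventually_elim auto
  then have "\<exists>\<mu>. \<mu> > 0 \<and> \<mu> < m \<and> (\<forall>i\<in>I. \<mu> < b i) \<and> (\<Sum>i\<in>I. c i / (b i - \<mu>)) < \<theta>"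
    by (rule eventually_happens'[rotated]) simp
  then show ?thesis using that by blast
qed

section \<open>Stabilization by finitely many controller states\<close>

theorem corollary4p2:
  fixes p q \<gamma> :: real and k :: "real \<Rightarrow> real" and f :: "L2 \<Rightarrow> L2"
    and Kb :: "nat \<Rightarrow> L2 \<Rightarrow> real" and Pb \<omega>b :: "nat \<Rightarrow> real"
  assumes "p > 0"
    and "\<gamma> / (p * pi\<^sup>2) \<ge> 0"
    and "continuous_on {0..1} k"
    and "achieves_ISS p q k (\<gamma> / (p * pi\<^sup>2))"
    and "continuous_on UNIV f"
    and "\<forall>i\<ge>1. continuous_on UNIV (Kb i)"
    and "\<forall>i\<ge>1. Pb i \<ge> 0"
    and "\<forall>i\<ge>1. \<omega>b i > 0"
    and "\<forall>i\<ge>1. \<forall>u. \<bar>Kb i u\<bar> \<le> Pb i * norm u"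
    and "(\<lambda>i. inverse ((\<omega>b i)\<^sup>2) * Pb i * norm (L2_of (phi_bar p q (\<omega>b i)))) summable_on {1..}"
    and "(\<Sum>\<^sub>\<infinity>i\<in>{1..}. inverse ((\<omega>b i)\<^sup>2) * Pb i * norm (L2_of (phi_bar p q (\<omega>b i)))) < 1"
    and "\<forall>\<epsilon>>0. \<exists>N\<ge>1. \<forall>u.
           norm (f u - (\<Sum>i=1..N. Kb i u *\<^sub>R L2_of (phi_bar p q (\<omega>b i)))) \<le> \<epsilon> * norm u"
  shows "\<exists>n\<ge>1. \<exists>\<phi> K \<omega>.
           (\<forall>i\<in>{1..n}. C2_on_01 (\<phi> i) \<and> \<phi> i 0 = 0 \<and> continuous_on UNIV (K i) \<and> \<omega> i > 0) \<and>
           globally_exponentially_stable p q k f n \<phi> K \<omega>"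
proof -
  define g where "g = \<gamma> / (p * pi\<^sup>2)"
  define \<phi> where "\<phi> i = phi_bar p q (\<omega>b i)" for i
  define c where "c i = norm (L2_of (\<phi> i))" for i
  define S where "S = (\<Sum>\<^sub>\<infinity>i\<in>{1..}. inverse ((\<omega>b i)\<^sup>2) * Pb i * c i)"
  \<comment> \<open>The gap \<open>1 - S\<close> is split in three: for the approximation error of \<open>f\<close>, for the passage from decay
    rate \<open>0\<close> to \<open>\<mu>\<close>, and for the margin that remains in the small-gain condition.\<close>
  define \<eta> where "\<eta> = (1 - S) / 3"
  have g: "g \<ge> 0" using assms(2) by (simp add: g_def)
  have c: "c i \<ge> 0" for i by (simp add: c_def)
  have S: "S < 1" using assms(11) by (simp add: S_def c_def \<phi>_def)
  then have \<eta>: "\<eta> > 0" by (simp add: \<eta>_def)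
  obtain G \<sigma> where G: "G > 0" and \<sigma>: "\<sigma> > 0" and
    iss: "\<And>v u t. (\<forall>t\<ge>0. square_integrable (v t)) \<Longrightarrow> pde_closed_loop p q k v u \<Longrightarrow> t \<ge> 0 \<Longrightarrow>
        ennreal (norm (L2_of (u t)))
           \<le> ennreal (G * exp (- \<sigma> * t) * norm (L2_of (u 0)))
             + ennreal g * (SUP s\<in>{0..t}. ennreal (norm (L2_of (v s))))"
    using assms(4) unfolding achieves_ISS_def g_def by blast
  \<comment> \<open>Only half of \<open>\<sigma>\<close> is used to shrink the initial state over a window, so that \<open>T\<close> can be fixed
    before \<open>\<mu>\<close> is known to be less than \<open>\<sigma> / 2\<close>.\<close>
  define T where "T = 2 * ln (2 * G + 1) / \<sigma>"
  have T: "T > 0" using G \<sigma> by (simp add: T_def)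
  have "exp (- (\<sigma> / 2) * T) = 1 / (2 * G + 1)"
    using G \<sigma> by (simp add: T_def exp_minus inverse_eq_divide)
  then have GT: "G * exp (- (\<sigma> / 2) * T) \<le> 1 / 2"
    using G by (simp only:) (simp add: field_simps)
  \<comment> \<open>\<open>2 e g\<close> is the gain of the weighted estimate for \<open>w\<close>, as \<open>\<mu> T < 1\<close>; the added \<open>1\<close> covers \<open>g = 0\<close>.\<close>
  define \<epsilon> where "\<epsilon> = \<eta> / (2 * exp 1 * g + 1)"
  have \<epsilon>: "\<epsilon> > 0" using \<eta> g by (simp add: \<epsilon>_def add_nonneg_pos)
  have "2 * exp 1 * g * \<epsilon> \<le> (2 * exp 1 * g + 1) * \<epsilon>"
    using \<epsilon> by (intro mult_right_mono) auto
  also have "2 * exp 1 * g + 1 \<noteq> 0" using g by (simp add: add_nonneg_eq_0_iff)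
  then have "(2 * exp 1 * g + 1) * \<epsilon> = \<eta>" by (simp add: \<epsilon>_def)
  finally have g\<epsilon>: "2 * exp 1 * g * \<epsilon> \<le> \<eta>" .
  obtain N where N: "N \<ge> 1" and
    f: "\<And>u. norm (f u - (\<Sum>i=1..N. Kb i u *\<^sub>R L2_of (\<phi> i))) \<le> \<epsilon> * norm u"
    using assms(12) \<epsilon> unfolding \<phi>_def by blast
  have "(\<Sum>i=1..N. c i * Pb i / (\<omega>b i)\<^sup>2) = (\<Sum>i=1..N. inverse ((\<omega>b i)\<^sup>2) * Pb i * c i)"
    by (intro sum.cong) (auto simp: field_simps)
  also have "\<dots> \<le> S"
    unfolding S_def using assms(7,10) c
    by (intro finite_sum_le_infsum) (auto simp: c_def \<phi>_def)
  also have "S < S + \<eta>" using \<eta> by simp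
  finally have "(\<Sum>i=1..N. c i * Pb i / (\<omega>b i)\<^sup>2) < S + \<eta>" .
  then obtain \<mu> where \<mu>: "\<mu> > 0" "\<mu> < min (\<sigma> / 2) (1 / T)"
    "\<And>i. i \<in> {1..N} \<Longrightarrow> \<mu> < (\<omega>b i)\<^sup>2" "(\<Sum>i=1..N. c i * Pb i / ((\<omega>b i)\<^sup>2 - \<mu>)) < S + \<eta>"
    by (rule small_decay_rate[rotated 2, where m = "min (\<sigma> / 2) (1 / T)"])
      (use assms(8) \<sigma> T in \<open>auto simp: less_imp_neq[symmetric]\<close>)
  have e\<mu>T: "exp (\<mu> * T) \<le> exp 1" using \<mu>(2) T by (simp add: field_simps)
  have "G * exp (- (\<sigma> - \<mu>) * T) \<le> G * exp (- (\<sigma> / 2) * T)"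
    using \<mu>(2) T G by (intro mult_left_mono, unfold exp_le_cancel_iff, intro mult_right_mono) auto
  with GT have G\<mu>: "G * exp (- (\<sigma> - \<mu>) * T) \<le> 1 / 2" by linarith
  define \<beta> where "\<beta> i = Pb i / ((\<omega>b i)\<^sup>2 - \<mu>)" for i
  have \<beta>: "\<beta> i \<ge> 0" if "i \<in> {1..N}" for i
    using that \<mu>(3)[OF that] assms(7) by (simp add: \<beta>_def)
  \<comment> \<open>In terms of the initial data \<open>z\<close> of the closed loop, \<open>A z\<close> bounds the initial norm of \<open>w\<close> and \<open>B z\<close>
    the weighted norm of \<open>u\<close>.\<close>
  define A where "A = 1 + (\<Sum>i=1..N. c i)"
  define B where "B = (2 * exp 1 * G + 1) * A / \<eta>"
  define R where "R = (1 + (\<Sum>i=1..N. \<beta> i)) * B + 1"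
  have A: "A \<ge> 1" by (simp add: A_def c sum_nonneg)
  have B: "B \<ge> 0" using A G \<eta> by (simp add: B_def)
  have R: "R > 0" using B \<beta> by (auto simp: R_def intro!: add_nonneg_pos mult_nonneg_nonneg add_nonneg_nonneg sum_nonneg)
  have stable: "norm (L2_of (u t)) + (\<Sum>i=1..N. \<bar>\<xi> i t\<bar>)
      \<le> R * exp (- \<mu> * t) * (norm (L2_of (u 0)) + (\<Sum>i=1..N. \<bar>\<xi> i 0\<bar>))"
    if cl: "closed_loop p q k f N \<phi> Kb \<omega>b u \<xi>" and t: "t \<ge> 0" for u \<xi> t
  proof -
    have "\<exists>\<phi>'. \<forall>i. (\<forall>x. (\<phi> i has_real_derivative \<phi>' i x) (at x)) \<and>
        (\<forall>x. (\<phi>' i has_real_derivative (q - (\<omega>b i)\<^sup>2) / p * \<phi> i x) (at x))"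
      unfolding \<phi>_def using phi_bar_eigenfunction[OF assms(1)] by (intro choice) metis
    then obtain \<phi>' where \<phi>': "\<And>i x. (\<phi> i has_real_derivative \<phi>' i x) (at x)"
      "\<And>i x. (\<phi>' i has_real_derivative (q - (\<omega>b i)\<^sup>2) / p * \<phi> i x) (at x)" by blast
    define w where "w t x = u t x - (\<Sum>i=1..N. \<xi> i t * \<phi> i x)" for t x
    obtain v where v: "\<And>t. t \<ge> 0 \<Longrightarrow> square_integrable (v t)"
      "\<And>t. t \<ge> 0 \<Longrightarrow>
        L2_of (v t) = f (L2_of (u t)) - (\<Sum>i=1..N. Kb i (L2_of (u t)) *\<^sub>R L2_of (\<phi> i))"
      and pde: "pde_closed_loop p q k v w"
      and w: "\<And>t. t \<ge> 0 \<Longrightarrow> L2_of (w t) = L2_of (u t) - (\<Sum>i=1..N. \<xi> i t *\<^sub>R L2_of (\<phi> i))"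
      using closed_loop_change_of_variable[OF cl _ assms(3) \<phi>'] assms(1)
      unfolding w_def \<phi>_def by (auto simp: phi_bar_0)
    have v_le: "norm (L2_of (v s)) \<le> \<epsilon> * norm (L2_of (u s))" if "s \<ge> 0" for s
      using f[of "L2_of (u s)"] v(2)[OF that] by simp
    define U where "U s = exp (\<mu> * s) * norm (L2_of (u s))" for s
    define W where "W s = exp (\<mu> * s) * norm (L2_of (w s))" for s
    define X where "X i s = exp (\<mu> * s) * \<bar>\<xi> i s\<bar>" for i s
    define z where "z = norm (L2_of (u 0)) + (\<Sum>i=1..N. \<bar>\<xi> i 0\<bar>)"
    have contU: "continuous_on {0..} U"
      unfolding U_def using cl by (intro continuous_intros) (auto simp: closed_loop_def regular_def)
    have U_nonneg: "U s \<ge> 0" for s by (simp add: U_def)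
    have split: "U s \<le> W s + (\<Sum>i=1..N. c i * X i s)" if "s \<ge> 0" for s
    proof -
      have eq: "L2_of (u s) = L2_of (w s) + (\<Sum>i=1..N. \<xi> i s *\<^sub>R L2_of (\<phi> i))"
        using w[OF that] by simp
      have "norm (L2_of (u s)) \<le> norm (L2_of (w s)) + (\<Sum>i=1..N. norm (\<xi> i s *\<^sub>R L2_of (\<phi> i)))"
        by (subst eq, rule norm_triangle_le) (intro add_left_mono norm_sum)
      then have "U s \<le> exp (\<mu> * s) * (norm (L2_of (w s)) + (\<Sum>i=1..N. \<bar>\<xi> i s\<bar> * c i))"
        unfolding U_def by (intro mult_left_mono) (simp_all add: c_def)
      then show ?thesis by (simp add: W_def X_def distrib_left sum_distrib_left mult_ac)
    qed
    have W_le: "W r \<le> 2 * exp 1 * G * norm (L2_of (w 0)) + 2 * exp 1 * g * \<epsilon> * D"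
      if r: "r \<ge> 0" and D: "D \<ge> 0" and UD: "\<And>s. s \<in> {0..r} \<Longrightarrow> U s \<le> D" for r D
    proof -
      have "W r \<le> 2 * exp (\<mu> * T) * (G * norm (L2_of (w 0)) + g * (\<epsilon> * D))"
        unfolding W_def
      proof (rule fading_memory[where d = "\<lambda>s. norm (L2_of (v s))" and \<sigma> = \<sigma> and t = r])
        fix t0 t B :: real
        assume *: "t0 \<ge> 0" "t \<ge> 0" "\<And>s. s \<in> {t0..t0 + t} \<Longrightarrow> norm (L2_of (v s)) \<le> B"
        show "norm (L2_of (w (t0 + t))) \<le> G * exp (- \<sigma> * t) * norm (L2_of (w t0)) + g * B"
          by (rule ISS_from_time[where v = v], rule iss) (use * v pde G g in auto)
      next
        fix s assume s: "s \<in> {0..r}"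
        have "exp (\<mu> * s) * norm (L2_of (v s)) \<le> \<epsilon> * U s"
          using s v_le[of s] by (simp add: U_def mult.left_commute)
        also have "\<dots> \<le> \<epsilon> * D" using UD[OF s] \<epsilon> by simp
        finally show "exp (\<mu> * s) * norm (L2_of (v s)) \<le> \<epsilon> * D" .
      qed (use r D \<epsilon> G g \<sigma> \<mu> T G\<mu> in auto)
      also have "\<dots> \<le> 2 * exp 1 * (G * norm (L2_of (w 0)) + g * (\<epsilon> * D))"
        using e\<mu>T G g \<epsilon> D by (intro mult_right_mono) auto
      finally show ?thesis by (simp add: algebra_simps)
    qed
    have X_le: "X i r \<le> \<bar>\<xi> i 0\<bar> + \<beta> i * D"
      if r: "r \<ge> 0" and D: "D \<ge> 0" and UD: "\<And>s. s \<in> {0..r} \<Longrightarrow> U s \<le> D" and i: "i \<in> {1..N}"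
      for r D i
    proof -
      have "exp (\<mu> * r) * \<bar>\<xi> i r\<bar> \<le> \<bar>\<xi> i 0\<bar> + Pb i * D / ((\<omega>b i)\<^sup>2 - \<mu>)"
      proof (rule linear_ode_fading_memory[where \<kappa> = "\<lambda>s. Kb i (L2_of (u s))"])
        have "continuous_on {0..} (\<xi> i)" using cl i by (simp add: closed_loop_def)
        then show "continuous_on {0..r} (\<xi> i)" by (rule continuous_on_subset) auto
      next
        fix s assume s: "0 < s" "s < r"
        have "\<xi> i C1_differentiable_on {0<..}" using cl i by (simp add: closed_loop_def)
        then have "(\<xi> i has_real_derivative deriv (\<xi> i) s) (at s)"
          using s by (intro C1_differentiable_on_imp_deriv) auto
        then show "(\<xi> i has_real_derivative - (\<omega>b i)\<^sup>2 * \<xi> i s + Kb i (L2_of (u s))) (at s)"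
          using cl i s by (simp add: closed_loop_def)
        have "exp (\<mu> * s) * \<bar>Kb i (L2_of (u s))\<bar> \<le> exp (\<mu> * s) * (Pb i * norm (L2_of (u s)))"
          using assms(9) i by (intro mult_left_mono) auto
        also have "\<dots> = Pb i * U s" by (simp add: U_def mult.left_commute)
        also have "\<dots> \<le> Pb i * D" using UD[of s] s i assms(7) by (intro mult_left_mono) auto
        finally show "exp (\<mu> * s) * \<bar>Kb i (L2_of (u s))\<bar> \<le> Pb i * D" .
      qed (use r D i assms(7) \<mu>(3) in auto)
      then show ?thesis by (simp add: X_def \<beta>_def)
    qed
    have z: "z \<ge> 0" by (simp add: z_def sum_nonneg)
    have \<xi>z: "(\<Sum>i=1..N. c i * \<bar>\<xi> i 0\<bar>) \<le> (A - 1) * z"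
      and w0: "norm (L2_of (w 0)) \<le> A * z"
    proof -
      have "\<bar>\<xi> i 0\<bar> \<le> z" if "i \<in> {1..N}" for i
        using member_le_sum[of i "{1..N}" "\<lambda>i. \<bar>\<xi> i 0\<bar>"] that
        by (simp add: z_def add_increasing)
      then show *: "(\<Sum>i=1..N. c i * \<bar>\<xi> i 0\<bar>) \<le> (A - 1) * z"
        by (simp add: A_def sum_distrib_right) (intro sum_mono mult_left_mono c, auto)
      have "norm (L2_of (w 0)) \<le> norm (L2_of (u 0)) + norm (\<Sum>i=1..N. \<xi> i 0 *\<^sub>R L2_of (\<phi> i))"
        by (simp add: w norm_triangle_ineq4)
      also have "\<dots> \<le> norm (L2_of (u 0)) + (\<Sum>i=1..N. c i * \<bar>\<xi> i 0\<bar>)"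
        by (intro add_left_mono order_trans[OF norm_sum]) (simp add: c_def mult.commute)
      also have "\<dots> \<le> z + (A - 1) * z"
        using * by (intro add_mono) (auto simp: z_def sum_nonneg)
      finally show "norm (L2_of (w 0)) \<le> A * z" by (simp add: algebra_simps)
    qed
    have U_le: "U s \<le> B * z" if "s \<ge> 0" for s
    proof -
      have "U s \<le> (2 * exp 1 * G * norm (L2_of (w 0)) + (\<Sum>i=1..N. c i * \<bar>\<xi> i 0\<bar>)) / \<eta>"
      proof (rule small_gain[OF contU U_nonneg split W_le X_le])
        show "2 * exp 1 * g * \<epsilon> + (\<Sum>i=1..N. c i * \<beta> i) \<le> 1 - \<eta>"
          using g\<epsilon> \<mu>(4) by (simp add: \<beta>_def \<eta>_def field_simps)
      qed (use that \<eta> c in auto)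
      also have "\<dots> \<le> (2 * exp 1 * G * (A * z) + A * z) / \<eta>"
        using \<xi>z w0 z G \<eta>
        by (intro divide_right_mono add_mono mult_left_mono) (auto simp: algebra_simps)
      finally show ?thesis by (simp add: B_def algebra_simps)
    qed
    have "exp (\<mu> * t) * (norm (L2_of (u t)) + (\<Sum>i=1..N. \<bar>\<xi> i t\<bar>)) = U t + (\<Sum>i=1..N. X i t)"
      by (simp add: U_def X_def distrib_left sum_distrib_left)
    also have "\<dots> \<le> B * z + (\<Sum>i=1..N. \<bar>\<xi> i 0\<bar> + \<beta> i * (B * z))"
      using t B z by (intro add_mono sum_mono X_le U_le) auto
    also have "\<dots> \<le> R * z"
      by (simp add: R_def z_def sum.distrib sum_distrib_right distrib_left distrib_right mult.assoc)
    finally show ?thesis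
      by (simp add: z_def exp_minus field_simps)
  qed
  have "globally_exponentially_stable p q k f N \<phi> Kb \<omega>b"
    unfolding globally_exponentially_stable_def using R \<mu>(1) stable by blast
  moreover have "\<forall>i\<in>{1..N}. C2_on_01 (\<phi> i) \<and> \<phi> i 0 = 0 \<and> continuous_on UNIV (Kb i) \<and> \<omega>b i > 0"
    using assms(1,6,8) by (auto simp: \<phi>_def C2_on_01_phi_bar phi_bar_0)
  ultimately show ?thesis using N by blast
qed

end
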